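(* Let $p,q\ge 1$ be integers, let $A_1,\dots,A_p>0$, $B_1,\dots,B_q>0$, $a_1,\dots,a_p\ge 0$, $b_1,\dots,b_q\ge 0$, and for $x>0$ put $$W(x)=\frac{\prod_{i=1}^{p}\Gamma(A_ix+a_i)}{\prod_{j=1}^{q}\Gamma(B_jx+b_j)},\qquad P(u)=\sum_{i=1}^{p}\frac{e^{-a_iu/A_i}}{1-e^{-u/A_i}}-\sum_{j=1}^{q}\frac{e^{-b_ju/B_j}}{1-e^{-u/B_j}}\quad(u>0).$$ Then $W$ is logarithmically completely monotonic on $(0,\infty)$ if and only if $$\sum_{j=1}^{q}B_j=\sum_{i=1}^{p}A_i,\qquad \rho:=\prod_{i=1}^{p}A_i^{A_i}\prod_{j=1}^{q}B_j^{-B_j}\le 1,$$ and $P(u)\ge 0$ for all $u>0$. In the affirmative case, for all $x>0$, $$-(\log W)'(x)=\int_{0}^{\infty}e^{-xu}P(u)\,du+\log(1/\rho).$$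
   Context: A nonnegative function $f$ on $(0,\infty)$ is completely monotonic (c.m.) if it has derivatives of all orders and $(-1)^nf^{(n)}(x)\ge 0$ for all $n\ge 1$, $x>0$. A positive function $f$ on $(0,\infty)$ is logarithmically completely monotonic (l.c.m.) if $-(\log f)'$ is completely monotonic on $(0,\infty)$. $\Gamma$ is Euler's gamma function. *)

theory Defs
  imports "HOL-Analysis.Analysis"
begin

text \<open>
  Functions on the positive half-line are total functions on the reals; only their values at
  positive arguments matter, since derivatives at a positive point are local. Because
  \<^const>\<open>deriv\<close> is total, differentiability is required explicitly.
\<close>

definition completely_monotonic :: "(real \<Rightarrow> real) \<Rightarrow> bool" where
  "completely_monotonic f \<longleftrightarrow>
     (\<forall>x>0. 0 \<le> f x) \<and>
     (\<forall>n. \<forall>x>0. ((deriv ^^ n) f) differentiable (at x)) \<and>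
     (\<forall>n\<ge>1. \<forall>x>0. 0 \<le> (- 1) ^ n * (deriv ^^ n) f x)"

definition log_completely_monotonic :: "(real \<Rightarrow> real) \<Rightarrow> bool" where
  "log_completely_monotonic f \<longleftrightarrow>
     (\<forall>x>0. 0 < f x) \<and>
     (\<forall>x>0. (\<lambda>y. ln (f y)) differentiable (at x)) \<and>
     completely_monotonic (\<lambda>x. - deriv (\<lambda>y. ln (f y)) x)"

definition gamma_ratio ::
  "nat \<Rightarrow> nat \<Rightarrow> (nat \<Rightarrow> real) \<Rightarrow> (nat \<Rightarrow> real) \<Rightarrow> (nat \<Rightarrow> real) \<Rightarrow> (nat \<Rightarrow> real) \<Rightarrow> real \<Rightarrow> real"
where
  "gamma_ratio p q A B a b x =
     (\<Prod>i=1..p. Gamma (A i * x + a i)) / (\<Prod>j=1..q. Gamma (B j * x + b j))"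

definition gamma_ratio_kernel ::
  "nat \<Rightarrow> nat \<Rightarrow> (nat \<Rightarrow> real) \<Rightarrow> (nat \<Rightarrow> real) \<Rightarrow> (nat \<Rightarrow> real) \<Rightarrow> (nat \<Rightarrow> real) \<Rightarrow> real \<Rightarrow> real"
where
  "gamma_ratio_kernel p q A B a b u =
     (\<Sum>i=1..p. exp (- (a i * u / A i)) / (1 - exp (- (u / A i)))) -
     (\<Sum>j=1..q. exp (- (b j * u / B j)) / (1 - exp (- (u / B j))))"

definition gamma_ratio_rho ::
  "nat \<Rightarrow> nat \<Rightarrow> (nat \<Rightarrow> real) \<Rightarrow> (nat \<Rightarrow> real) \<Rightarrow> real"
where
  "gamma_ratio_rho p q A B = (\<Prod>i=1..p. A i powr A i) * (\<Prod>j=1..q. B j powr (- B j))"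

end

theory Submission
  imports Defs "HOL-Probability.Distributions" "HOL-Real_Asymp.Real_Asymp"
begin

text \<open>
  Write \<open>D = - (log W)'\<close> (\<open>D 0\<close> below, with derivatives \<open>D n\<close>). The polygamma functions in the
  derivatives of \<open>D\<close> expand into partial fractions with poles at \<open>- (a + k) / A\<close>. This links their
  signs to \<open>P\<close>, because the same points are the exponents in the geometric series
  \<open>\<Sum>k. exp (- ((a + k) / A * u)) = exp (- (a * u / A)) / (1 - exp (- (u / A)))\<close>, whose signed sum over
  all factors is \<open>P u\<close>.

  \<^bold>\<open>Necessity.\<close> Since \<open>Digamma x - ln x\<close> vanishes at infinity,
  \<open>D x = ((\<Sum>j. B j) - (\<Sum>i. A i)) * ln x - ln \<rho> + o(1)\<close>. A completely monotonic function is nonnegative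
  and decreasing, hence bounded near infinity, so the logarithmic term must cancel, and then the
  limit \<open>- ln \<rho>\<close> must be nonnegative. For the kernel, evaluate the \<open>n\<close>-th derivative of \<open>D\<close> at
  \<open>x = (n + 1) / u\<close> and multiply by \<open>(-1) ^ n * x ^ (n + 1) / n!\<close>, as in the Post-Widder inversion
  formula. Up to sign, each pole contributes \<open>(1 + c * u / (n + 1)) ^ - (n + 1)\<close> with
  \<open>c = (a + k) / A\<close>, which tends to \<open>exp (- (c * u))\<close>. By dominated convergence for series the whole
  expression, which is nonnegative, tends to \<open>P u\<close> (\<open>Post_Widder_P\<close>). No integral representation is
  involved in this direction.

  \<^bold>\<open>Sufficiency and the formula.\<close> Each partial fraction is an elementary Laplace integral, so summing
  over the poles gives the derivatives of order \<open>n \<ge> 1\<close> as \<open>\<integral> u ^ n * exp (- (x * u)) * P u\<close> up to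
  the sign \<open>(-1) ^ n\<close> (\<open>has_bochner_integral_D\<close>). For \<open>D\<close> itself the series for a single factor
  diverges; only differences \<open>D x - D y\<close> have such a representation
  (\<open>has_bochner_integral_D_diff\<close>). If \<open>P \<ge> 0\<close> and the parameters are balanced, letting
  \<open>y \<rightarrow> \<infinity>\<close> under the integral by monotone convergence gives both the integrability of
  \<open>exp (- (x * u)) * P u\<close> and the value \<open>D x + ln \<rho>\<close> (\<open>has_bochner_integral_laplace_P\<close>).
  Nonnegativity of all the integrands then yields complete monotonicity.
\<close>

section \<open>A single gamma factor\<close>

definition gamma_kernel :: "real \<Rightarrow> real \<Rightarrow> real \<Rightarrow> real" where
  "gamma_kernel A a u = exp (- (a * u / A)) / (1 - exp (- (u / A)))"

text \<open>
  The derivative of order \<open>n + 1\<close> of \<open>\<lambda>x. ln (Gamma (A * x + a))\<close>.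
\<close>

definition scaled_Polygamma :: "nat \<Rightarrow> real \<Rightarrow> real \<Rightarrow> real \<Rightarrow> real" where
  "scaled_Polygamma n A a x = A ^ Suc n * Polygamma n (A * x + a)"

lemma arg_pos:
  fixes A a x :: real
  assumes "0 < A" "0 \<le> a" "0 < x"
  shows "0 < A * x + a"
  using assms by (simp add: add_pos_nonneg)

lemma pos_notin_nonpos_Ints: "(0::real) < x \<Longrightarrow> x \<notin> \<int>\<^sub>\<le>\<^sub>0"
  by (auto elim!: nonpos_Ints_cases)

lemma DERIV_scaled_Polygamma:
  assumes "0 < A" "0 \<le> a" "0 < x"
  shows "(scaled_Polygamma n A a has_real_derivative scaled_Polygamma (Suc n) A a x) (at x)"
  unfolding scaled_Polygamma_def [abs_def]
  by (rule derivative_eq_intros refl pos_notin_nonpos_Ints arg_pos assms)+ (simp add: algebra_simps)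

lemma DERIV_ln_Gamma_affine:
  assumes "0 < A" "0 \<le> a" "0 < x"
  shows "((\<lambda>y. ln (Gamma (A * y + a))) has_real_derivative scaled_Polygamma 0 A a x) (at x)"
proof -
  have "((\<lambda>y. ln_Gamma (A * y + a)) has_real_derivative scaled_Polygamma 0 A a x) (at x)"
    unfolding scaled_Polygamma_def
    by (rule derivative_eq_intros refl arg_pos assms)+ simp
  then show ?thesis
  proof (rule has_field_derivative_transform_within_open [of _ _ _ "{0<..}"])
    show "ln_Gamma (A * y + a) = ln (Gamma (A * y + a))" if "y \<in> {0<..}" for y
      using that assms by (intro ln_Gamma_real_pos arg_pos) auto
  qed (use assms in auto)
qed

lemma gamma_kernel_sums:
  assumes "0 < A" "0 < u"
  shows "(\<lambda>k. exp (- ((a + real k) / A * u))) sums gamma_kernel A a u"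
proof -
  have "(\<lambda>k. exp (- (a * u / A)) * exp (- (u / A)) ^ k) sums
          (exp (- (a * u / A)) * (1 / (1 - exp (- (u / A)))))"
    using assms by (intro sums_mult geometric_sums) auto
  moreover have "exp (- (a * u / A)) * exp (- (u / A)) ^ k = exp (- ((a + real k) / A * u))" for k
    by (simp add: exp_of_nat_mult [symmetric] exp_add [symmetric] add_divide_distrib algebra_simps
             flip: exp_add exp_of_nat_mult)
  ultimately show ?thesis
    by (simp add: gamma_kernel_def)
qed

text \<open>
  The factor \<open>A ^ Suc n\<close> from the chain rule moves the poles of the partial fractions to
  \<open>- (a + k) / A\<close>; these are the exponents in the geometric series of \<open>gamma_kernel_sums\<close>.
\<close>

lemma scaled_Polygamma_sums:
  assumes "0 < A" "0 \<le> a" "0 < x" "1 \<le> n"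
  shows "(\<lambda>k. fact n / (x + (a + real k) / A) ^ Suc n) sums ((-1) ^ Suc n * scaled_Polygamma n A a x)"
proof -
  have "(\<lambda>k. inverse ((A * x + a + real k) ^ Suc n)) sums
          ((-1) ^ Suc n * Polygamma n (A * x + a) / fact n)"
    using Polygamma_LIMSEQ [of "A * x + a" n] arg_pos [OF assms(1-3)] assms(4) by auto
  from sums_mult [OF this, of "fact n * A ^ Suc n"]
  have "(\<lambda>k. fact n * A ^ Suc n * inverse ((A * x + a + real k) ^ Suc n)) sums
          ((-1) ^ Suc n * scaled_Polygamma n A a x)"
    by (simp add: scaled_Polygamma_def mult_ac)
  moreover have "fact n * A ^ Suc n * inverse ((A * x + a + real k) ^ Suc n) =
      fact n / (x + (a + real k) / A) ^ Suc n" for k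
  proof -
    define e where "e = x + (a + real k) / A"
    have "A * x + a + real k = A * e"
      using assms by (simp add: e_def field_simps)
    then show ?thesis
      using assms(1) unfolding e_def [symmetric]
      by (simp add: power_mult_distrib divide_simps del: power_Suc)
  qed
  ultimately show ?thesis by simp
qed

text \<open>
  Taking a difference removes the convergence-producing terms \<open>1 / (k + 1)\<close> of the digamma series,
  so that again only shifted reciprocals, that is Laplace integrals, remain.
\<close>

lemma scaled_Digamma_diff_sums:
  assumes "0 < A" "0 \<le> a" "0 < x" "0 < y"
  shows "(\<lambda>k. 1 / (x + (a + real k) / A) - 1 / (y + (a + real k) / A)) sums
           (scaled_Polygamma 0 A a y - scaled_Polygamma 0 A a x)"
proof -
  have *: "(\<lambda>k. inverse (of_nat (Suc k)) - inverse (A * z + a + real k)) sums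
          (Polygamma 0 (A * z + a) + euler_mascheroni)" if "0 < z" for z
    using summable_sums [OF summable_Digamma [of "A * z + a"]] arg_pos [OF assms(1,2) that]
    by (simp add: Digamma_def)
  from sums_mult [OF sums_diff [OF * [OF assms(4)] * [OF assms(3)]], of A]
  have "(\<lambda>k. A * (inverse (A * x + a + real k) - inverse (A * y + a + real k))) sums
          (scaled_Polygamma 0 A a y - scaled_Polygamma 0 A a x)"
    by (simp add: scaled_Polygamma_def algebra_simps)
  moreover have "A * inverse (A * z + a + real k) = 1 / (z + (a + real k) / A)" if "0 < z" for z k
  proof -
    define e where "e = z + (a + real k) / A"
    have "A * z + a + real k = A * e"
      using assms by (simp add: e_def field_simps)
    then show ?thesis
      using assms(1) unfolding e_def [symmetric] by (simp add: divide_simps)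
  qed
  ultimately show ?thesis
    using assms(3,4) by (simp add: right_diff_distrib)
qed

section \<open>Laplace integrals of the kernel\<close>

text \<open>
  This is the total mass of the Erlang density, up to normalisation and the null set \<open>{0}\<close>.
\<close>

lemma has_bochner_integral_power_times_exp:
  assumes "0 < s"
  shows "has_bochner_integral lborel (\<lambda>u::real. indicator {0<..} u * (u ^ n * exp (- (s * u))))
           (fact n / s ^ Suc n)"
proof -
  have "(\<integral>\<^sup>+ u. ennreal (erlang_density n s u) \<partial>lborel) = ennreal 1"
    using nn_integral_erlang_ith_moment [OF assms, of n 0] by simp
  then have "has_bochner_integral lborel (erlang_density n s) 1"
    by (intro has_bochner_integral_nn_integral) (auto simp: assms less_imp_le)
  from has_bochner_integral_mult_left [OF this, of "fact n / s ^ Suc n"]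
  have "has_bochner_integral lborel (\<lambda>u. fact n / s ^ Suc n * erlang_density n s u) (fact n / s ^ Suc n)"
    by (simp add: mult_ac)
  then show ?thesis
  proof (rule has_bochner_integral_cong_AE [THEN iffD1, rotated -1])
    have "AE u in lborel. u \<noteq> (0::real)"
      by (rule AE_lborel_singleton)
    then show "AE u in lborel. fact n / s ^ Suc n * erlang_density n s u =
        indicator {0<..} u * (u ^ n * exp (- (s * u)))"
      by eventually_elim (use assms in \<open>auto simp: erlang_density_def indicator_def field_simps\<close>)
  qed auto
qed

text \<open>
  Termwise integration against the geometric series of the kernel. As all terms are nonnegative,
  convergence of the series of integrals is enough to interchange. The weight \<open>\<phi>\<close> will be
  \<open>u ^ n * exp (- (x * u))\<close> for the higher derivatives and \<open>exp (- (x * u)) - exp (- (y * u))\<close> for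
  differences of digamma values; both make the integral converge at \<open>0\<close>, where the kernel behaves
  like \<open>A / u\<close>.
\<close>

lemma has_bochner_integral_gamma_kernel:
  assumes "0 < A"
    and [measurable]: "\<phi> \<in> borel_measurable lborel"
    and nonneg: "\<And>u. 0 < u \<Longrightarrow> 0 \<le> \<phi> u"
    and int: "\<And>k. has_bochner_integral lborel
           (\<lambda>u. indicator {0<..} u * (\<phi> u * exp (- ((a + real k) / A * u)))) (s k)"
    and s: "s sums S"
  shows "has_bochner_integral lborel (\<lambda>u. indicator {0<..} u * (\<phi> u * gamma_kernel A a u)) S"
proof -
  let ?f = "\<lambda>k u. indicator {0<..} u * (\<phi> u * exp (- ((a + real k) / A * u)))"
  have norm_f: "norm (?f k u) = ?f k u" for k u
    using nonneg by (auto simp: indicator_def)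
  have sums: "(\<lambda>k. ?f k u) sums (indicator {0<..} u * (\<phi> u * gamma_kernel A a u))" for u
    using gamma_kernel_sums [OF assms(1), of u a]
    by (cases "0 < u") (auto intro!: sums_mult)
  have summable_norm: "summable (\<lambda>k. norm (?f k u))" for u
    unfolding norm_f using sums by (rule sums_summable)
  have integral_norm: "(\<integral>u. norm (?f k u) \<partial>lborel) = s k" for k
    unfolding norm_f by (rule has_bochner_integral_integral_eq [OF int])
  have int': "integrable lborel (?f k)" for k
    using int by (simp only: has_bochner_integral_iff)
  have summable_integral: "summable (\<lambda>k. \<integral>u. norm (?f k u) \<partial>lborel)"
    unfolding integral_norm using s by (rule sums_summable)
  note interchange = int' AE_I2 [OF summable_norm] summable_integral
  have 1: "integrable lborel (\<lambda>u. \<Sum>k. ?f k u)"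
    by (rule integrable_suminf [OF interchange])
  have 2: "(\<integral>u. (\<Sum>k. ?f k u) \<partial>lborel) = (\<Sum>k. \<integral>u. ?f k u \<partial>lborel)"
    by (rule integral_suminf [OF interchange])
  from 1 2 s show ?thesis
    unfolding has_bochner_integral_iff sums_unique [OF sums, symmetric]
      has_bochner_integral_integral_eq [OF int]
    by (simp add: sums_iff)
qed

lemma has_bochner_integral_scaled_Polygamma:
  assumes "0 < A" "0 \<le> a" "0 < x" "1 \<le> n"
  shows "has_bochner_integral lborel
           (\<lambda>u. indicator {0<..} u * (u ^ n * exp (- (x * u)) * gamma_kernel A a u))
           ((-1) ^ Suc n * scaled_Polygamma n A a x)"
proof (rule has_bochner_integral_gamma_kernel)
  fix k
  have "0 < x + (a + real k) / A"
    using assms by (simp add: add_pos_nonneg)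
  from has_bochner_integral_power_times_exp [OF this, of n]
  show "has_bochner_integral lborel
      (\<lambda>u. indicator {0<..} u * (u ^ n * exp (- (x * u)) * exp (- ((a + real k) / A * u))))
      (fact n / (x + (a + real k) / A) ^ Suc n)"
    by (simp add: distrib_right mult.assoc flip: exp_add)
qed (use assms scaled_Polygamma_sums in auto)

lemma has_bochner_integral_scaled_Digamma_diff:
  assumes "0 < A" "0 \<le> a" "0 < x" "x \<le> y"
  shows "has_bochner_integral lborel
           (\<lambda>u. indicator {0<..} u * ((exp (- (x * u)) - exp (- (y * u))) * gamma_kernel A a u))
           (scaled_Polygamma 0 A a y - scaled_Polygamma 0 A a x)"
proof (rule has_bochner_integral_gamma_kernel)
  fix k
  have *: "has_bochner_integral lborel
      (\<lambda>u. indicator {0<..} u * (exp (- (z * u)) * exp (- ((a + real k) / A * u))))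
      (1 / (z + (a + real k) / A))" if "0 < z" for z
  proof -
    have "0 < z + (a + real k) / A"
      using assms that by (simp add: add_pos_nonneg)
    from has_bochner_integral_power_times_exp [OF this, of 0] show ?thesis
      by (simp add: distrib_right flip: exp_add)
  qed
  have "0 < y" using assms by simp
  from has_bochner_integral_diff [OF * [OF assms(3)] * [OF this]]
  show "has_bochner_integral lborel
      (\<lambda>u. indicator {0<..} u * ((exp (- (x * u)) - exp (- (y * u))) * exp (- ((a + real k) / A * u))))
      (1 / (x + (a + real k) / A) - 1 / (y + (a + real k) / A))"
    by (simp add: algebra_simps)
qed (use assms scaled_Digamma_diff_sums in auto)

lemma nonneg_has_bochner_integral:
  fixes f :: "'a \<Rightarrow> real"
  assumes "has_bochner_integral M f I" "\<And>x. 0 \<le> f x"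
  shows "0 \<le> I"
proof -
  have "0 \<le> integral\<^sup>L M f"
    by (intro Bochner_Integration.integral_nonneg assms)
  with assms(1) show ?thesis by (simp add: has_bochner_integral_iff)
qed

section \<open>Behaviour of the digamma function at infinity\<close>

text \<open>
  By the mean value theorem \<open>ln x = ln_Gamma (x + 1) - ln_Gamma x\<close> is a value of the increasing
  function \<open>Digamma\<close> between \<open>x\<close> and \<open>x + 1\<close>, and \<open>Digamma (x + 1) = Digamma x + 1 / x\<close>.
\<close>

lemma Digamma_ln_bounds:
  fixes x :: real
  assumes "0 < x"
  shows "ln x - 1 / x \<le> Digamma x" and "Digamma x \<le> ln x"
proof -
  have "\<exists>z>x. z < x + 1 \<and> ln_Gamma (x + 1) - ln_Gamma x = (x + 1 - x) * Digamma z"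
    using assms by (intro MVT2) (auto intro!: derivative_eq_intros)
  then obtain z where z: "x < z" "z < x + 1" "ln_Gamma (x + 1) - ln_Gamma x = Digamma z"
    by auto
  have "ln_Gamma (x + 1) - ln_Gamma x = ln x"
    using assms Gamma_plus1 [of x] pos_notin_nonpos_Ints [of x]
    by (simp add: ln_Gamma_real_pos ln_mult Gamma_eq_zero_iff)
  with z have "Digamma z = ln x" by simp
  moreover have "Digamma x \<le> Digamma z" "Digamma z \<le> Digamma (x + 1)"
    using z assms by (auto intro!: Digamma_real_mono)
  moreover have "Digamma (x + 1) = Digamma x + 1 / x"
    using assms by (simp add: Digamma_plus1)
  ultimately show "ln x - 1 / x \<le> Digamma x" and "Digamma x \<le> ln x" by auto
qed

lemma tendsto_Digamma_minus_ln: "((\<lambda>x::real. Digamma x - ln x) \<longlongrightarrow> 0) at_top"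
proof (rule tendsto_sandwich)
  show "eventually (\<lambda>x::real. - (1 / x) \<le> Digamma x - ln x) at_top"
    using eventually_gt_at_top [of 0] by eventually_elim (use Digamma_ln_bounds in fastforce)
  show "eventually (\<lambda>x::real. Digamma x - ln x \<le> 0) at_top"
    using eventually_gt_at_top [of 0] by eventually_elim (use Digamma_ln_bounds in fastforce)
qed (real_asymp | simp)+

lemma tendsto_scaled_Digamma_minus_ln:
  assumes "0 < A" "0 \<le> a"
  shows "((\<lambda>x. scaled_Polygamma 0 A a x - A * ln x) \<longlongrightarrow> A * ln A) at_top"
proof -
  have "((\<lambda>x. Digamma (A * x + a) - ln (A * x + a)) \<longlongrightarrow> 0) at_top"
    by (rule filterlim_compose [OF tendsto_Digamma_minus_ln]) (use assms in real_asymp)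
  moreover have "((\<lambda>x. ln (A * x + a) - ln x) \<longlongrightarrow> ln A) at_top"
    using assms by real_asymp
  ultimately have "((\<lambda>x. A * (Digamma (A * x + a) - ln (A * x + a) + (ln (A * x + a) - ln x)))
      \<longlongrightarrow> A * (0 + ln A)) at_top"
    by (intro tendsto_intros)
  then show ?thesis
    by (simp add: scaled_Polygamma_def algebra_simps)
qed

section \<open>Recovering the kernel from high derivatives\<close>

text \<open>
  Post-Widder inversion for a single factor, done on the series instead of the integral: at
  \<open>x = m / u\<close> with \<open>m = n + 1\<close> the term with pole \<open>- c\<close> becomes \<open>(1 + c * u / m) ^ - m\<close>, and
  Tannery's theorem applies. Only even \<open>m = 2 * Suc j\<close> are used: the signs disappear, and the square
  of Bernoulli's inequality gives \<open>(1 + y / m) ^ m \<ge> (1 + y / 2)\<^sup>2\<close>, a summable majorant. Bernoulli's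
  inequality alone would only give the majorant \<open>1 / (1 + y)\<close>, whose sum over the poles diverges.
\<close>

lemma Post_Widder_gamma_kernel:
  assumes "0 < A" "0 \<le> a" "0 < u"
  shows "(\<lambda>j. (real (2 * Suc j) / u) ^ (2 * Suc j) / fact (2 * j + 1) *
            scaled_Polygamma (2 * j + 1) A a (real (2 * Suc j) / u)) \<longlonglongrightarrow> gamma_kernel A a u"
proof -
  define c where "c k = (a + real k) / A * u" for k
  have c: "0 \<le> c k" for k
    using assms by (simp add: c_def)
  define g where "g k j = inverse ((1 + c k / real (2 * Suc j)) ^ (2 * Suc j))" for k j
  have eq: "(real (2 * Suc j) / u) ^ (2 * Suc j) / fact (2 * j + 1) *
      scaled_Polygamma (2 * j + 1) A a (real (2 * Suc j) / u) = (\<Sum>k. g k j)" for j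
  proof -
    define m where "m = 2 * Suc j"
    define x where "x = real m / u"
    have m: "m = Suc (2 * j + 1)" "0 < m" by (auto simp: m_def)
    have x: "0 < x" using assms m by (simp add: x_def)
    have "(\<lambda>k. fact (2 * j + 1) / (x + (a + real k) / A) ^ m) sums scaled_Polygamma (2 * j + 1) A a x"
      using scaled_Polygamma_sums [OF assms(1,2) x, of "2 * j + 1"] by (simp add: m del: power_Suc fact_Suc)
    from sums_mult [OF this, of "x ^ m / fact (2 * j + 1)"]
    have "(\<lambda>k. x ^ m / (x + (a + real k) / A) ^ m) sums
        (x ^ m / fact (2 * j + 1) * scaled_Polygamma (2 * j + 1) A a x)"
      by (simp del: fact_Suc)
    moreover have "x ^ m / (x + (a + real k) / A) ^ m = g k j" for k
    proof -
      have "x + (a + real k) / A = x * (1 + c k / real m)"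
      proof -
        have "x * (c k / real m) = (a + real k) / A"
          using assms(3) m(2) by (simp add: x_def c_def)
        then show ?thesis by (simp add: distrib_left)
      qed
      moreover have "x ^ m / (x * e) ^ m = inverse (e ^ m)" for e
        using x by (simp add: power_mult_distrib inverse_eq_divide)
      ultimately show ?thesis
        unfolding g_def m_def [symmetric] by (simp only:)
    qed
    ultimately show ?thesis
      by (simp add: sums_iff m_def x_def)
  qed
  have lim: "(\<lambda>j. g k j) \<longlonglongrightarrow> exp (- c k)" for k
  proof -
    have "filterlim (\<lambda>j::nat. 2 * Suc j) at_top at_top"
      by (rule filterlim_subseq) (simp add: strict_mono_def)
    from filterlim_compose [OF tendsto_exp_limit_sequentially [of "c k"] this]
    have "(\<lambda>j. inverse ((1 + c k / real (2 * Suc j)) ^ (2 * Suc j))) \<longlonglongrightarrow> inverse (exp (c k))"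
      by (intro tendsto_inverse) auto
    then show ?thesis by (simp add: g_def exp_minus del: of_nat_mult of_nat_Suc power_Suc mult_Suc_right)
  qed
  have bound: "norm (g k j) \<le> inverse ((1 + c k / 2) ^ 2)" for k j
  proof -
    have "real (Suc j) * (c k / 2 / real (Suc j)) = c k / 2"
      by (simp del: of_nat_Suc)
    moreover have "-1 \<le> c k / 2 / real (Suc j)"
      by (rule order_trans [of _ 0]) (use c [of k] in auto)
    ultimately have "1 + c k / 2 \<le> (1 + c k / 2 / real (Suc j)) ^ Suc j"
      using Bernoulli_inequality [of "c k / 2 / real (Suc j)" "Suc j"] by (simp only:)
    then have "(1 + c k / 2) ^ 2 \<le> ((1 + c k / 2 / real (Suc j)) ^ Suc j) ^ 2"
      using c [of k] by (intro power_mono) auto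
    also have "\<dots> = (1 + c k / real (2 * Suc j)) ^ (2 * Suc j)"
      by (simp add: power_mult [symmetric] mult.commute del: power_Suc mult_Suc_right mult_Suc)
    finally have "inverse ((1 + c k / real (2 * Suc j)) ^ (2 * Suc j)) \<le> inverse ((1 + c k / 2) ^ 2)"
      using c [of k] by (intro le_imp_inverse_le) (auto intro!: zero_less_power add_pos_nonneg)
    moreover have "0 \<le> g k j"
      using c [of k] by (simp add: g_def del: power_Suc)
    ultimately show ?thesis by (simp add: g_def del: power_Suc)
  qed
  have summable_bound: "summable (\<lambda>k. inverse ((1 + c k / 2) ^ 2))"
  proof -
    \<comment> \<open>Up to a constant factor the majorant is the trigamma series at \<open>2 * A / u + a\<close>.\<close>
    have "0 < 2 * A / u + a" using assms by (simp add: add_pos_nonneg)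
    then have "summable (\<lambda>k. (2 * A / u) ^ 2 * inverse ((2 * A / u + a + real k) ^ 2))"
      using Polygamma_converges' [of "2 * A / u + a" 2] by (intro summable_mult) auto
    moreover have "(2 * A / u) ^ 2 * inverse ((2 * A / u + a + real k) ^ 2) = inverse ((1 + c k / 2) ^ 2)" for k
    proof -
      have "2 * A / u + a + real k = 2 * A / u * (1 + c k / 2)"
        using assms by (simp add: c_def field_simps)
      then show ?thesis
        using assms by (simp add: power_mult_distrib divide_simps)
    qed
    ultimately show ?thesis by simp
  qed
  have "eventually (\<lambda>(k, j). norm (g k j) \<le> inverse ((1 + c k / 2) ^ 2)) (at_top \<times>\<^sub>F sequentially)"
    by (rule always_eventually) (use bound in auto)
  from tannerys_theorem [OF lim this summable_bound]
  have "(\<lambda>j. \<Sum>k. g k j) \<longlonglongrightarrow> (\<Sum>k. exp (- c k))"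
    by simp
  also have "(\<Sum>k. exp (- c k)) = gamma_kernel A a u"
    using gamma_kernel_sums [OF assms(1,3), of a] by (simp add: c_def sums_iff)
  finally show ?thesis by (simp only: eq)
qed

section \<open>The gamma ratio\<close>

text \<open>
  A chain of functions, each the derivative of the preceding one on the half-line, carries the
  iterated \<^const>\<open>deriv\<close> together with its differentiability, so complete monotonicity becomes one
  uniform family of sign conditions.
\<close>

lemma completely_monotonic_iff_derivatives:
  assumes G: "\<And>n x. 0 < x \<Longrightarrow> (G n has_real_derivative G (Suc n) x) (at x)"
    and f: "\<And>x. 0 < x \<Longrightarrow> f x = G 0 x"
  shows "completely_monotonic f \<longleftrightarrow> (\<forall>n. \<forall>x>0. 0 \<le> (-1) ^ n * G n x)"
proof -
  have open_pos: "open {0::real<..}" by simp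
  have step: "((deriv ^^ n) f has_real_derivative G (Suc n) x) (at x)"
    if "\<And>y. 0 < y \<Longrightarrow> (deriv ^^ n) f y = G n y" "0 < x" for n x
    by (rule has_field_derivative_transform_within_open [OF G [of x n] open_pos]) (use that in auto)
  have higher: "(deriv ^^ n) f x = G n x" if "0 < x" for n x
    using that
  proof (induction n arbitrary: x)
    case (Suc n)
    then show ?case using DERIV_imp_deriv [OF step [of n x]] by simp
  qed (simp add: f)
  have diff: "(deriv ^^ n) f differentiable (at x)" if "0 < x" for n x
    using step [OF higher that] by (auto simp: real_differentiable_def)
  have "completely_monotonic f \<longleftrightarrow>
      (\<forall>x>0. 0 \<le> G 0 x) \<and> (\<forall>n\<ge>1. \<forall>x>0. 0 \<le> (-1) ^ n * G n x)"
    using diff by (simp add: completely_monotonic_def higher f cong: conj_cong)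
  also have "\<dots> \<longleftrightarrow> (\<forall>n. \<forall>x>0. 0 \<le> (-1) ^ n * G n x)"
  proof -
    have "Q 0 \<and> (\<forall>n\<ge>1. Q n) \<longleftrightarrow> (\<forall>n. Q n)" for Q :: "nat \<Rightarrow> bool"
      by (metis less_one not_le)
    from this [of "\<lambda>n. \<forall>x>0. 0 \<le> (-1) ^ n * G n x"] show ?thesis by simp
  qed
  finally show ?thesis .
qed

locale gamma_ratio_parameters =
  fixes p q :: nat and A B a b :: "nat \<Rightarrow> real"
  assumes A: "\<And>i. i \<in> {1..p} \<Longrightarrow> 0 < A i"
    and B: "\<And>j. j \<in> {1..q} \<Longrightarrow> 0 < B j"
    and a: "\<And>i. i \<in> {1..p} \<Longrightarrow> 0 \<le> a i"
    and b: "\<And>j. j \<in> {1..q} \<Longrightarrow> 0 \<le> b j"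
begin

abbreviation W :: "real \<Rightarrow> real" where
  "W \<equiv> gamma_ratio p q A B a b"

abbreviation P :: "real \<Rightarrow> real" where
  "P \<equiv> gamma_ratio_kernel p q A B a b"

abbreviation \<rho> :: real where
  "\<rho> \<equiv> gamma_ratio_rho p q A B"

text \<open>
  The \<open>n\<close>-th derivative of \<open>- (log W)'\<close>; the denominator of \<open>W\<close> therefore counts positively.
\<close>

definition D :: "nat \<Rightarrow> real \<Rightarrow> real" where
  "D n x = (\<Sum>j=1..q. scaled_Polygamma n (B j) (b j) x) -
           (\<Sum>i=1..p. scaled_Polygamma n (A i) (a i) x)"

lemma P_eq: "P u = (\<Sum>i=1..p. gamma_kernel (A i) (a i) u) - (\<Sum>j=1..q. gamma_kernel (B j) (b j) u)"
  by (simp add: gamma_ratio_kernel_def gamma_kernel_def)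

lemma gamma_ratio_pos: "0 < x \<Longrightarrow> 0 < W x"
  unfolding gamma_ratio_def
  by (intro divide_pos_pos prod_pos Gamma_real_pos arg_pos A a B b)

lemma DERIV_ln_gamma_ratio:
  assumes "0 < x"
  shows "((\<lambda>y. ln (W y)) has_real_derivative - D 0 x) (at x)"
proof -
  have "((\<lambda>y. (\<Sum>i=1..p. ln (Gamma (A i * y + a i))) - (\<Sum>j=1..q. ln (Gamma (B j * y + b j))))
      has_real_derivative - D 0 x) (at x)"
    unfolding D_def minus_diff_eq
    by (intro DERIV_diff DERIV_sum DERIV_ln_Gamma_affine A a B b assms)
  then show ?thesis
  proof (rule has_field_derivative_transform_within_open [of _ _ _ "{0<..}"])
    fix y :: real assume "y \<in> {0<..}"
    then have y: "0 < y" by simp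
    have 1: "0 < Gamma (A i * y + a i)" if "i \<in> {1..p}" for i
      by (intro Gamma_real_pos arg_pos A a that y)
    have 2: "0 < Gamma (B j * y + b j)" if "j \<in> {1..q}" for j
      by (intro Gamma_real_pos arg_pos B b that y)
    have "ln (W y) = ln (\<Prod>i=1..p. Gamma (A i * y + a i)) - ln (\<Prod>j=1..q. Gamma (B j * y + b j))"
      unfolding gamma_ratio_def by (intro ln_divide_pos prod_pos 1 2)
    also have "\<dots> = (\<Sum>i=1..p. ln (Gamma (A i * y + a i))) - (\<Sum>j=1..q. ln (Gamma (B j * y + b j)))"
      by (intro arg_cong2 [where f = "(-)"] ln_prod 1 2 [THEN less_imp_neq, THEN not_sym]
            1 [THEN less_imp_neq, THEN not_sym]) auto
    finally show "(\<Sum>i=1..p. ln (Gamma (A i * y + a i))) - (\<Sum>j=1..q. ln (Gamma (B j * y + b j))) = ln (W y)"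
      by simp
  qed (use assms in auto)
qed

lemma DERIV_D: "0 < x \<Longrightarrow> (D n has_real_derivative D (Suc n) x) (at x)"
  unfolding D_def [abs_def]
  by (intro DERIV_diff DERIV_sum DERIV_scaled_Polygamma A a B b)

lemma deriv_ln_gamma_ratio: "0 < x \<Longrightarrow> - deriv (\<lambda>y. ln (W y)) x = D 0 x"
  using DERIV_imp_deriv [OF DERIV_ln_gamma_ratio] by simp

lemma log_completely_monotonic_iff_D:
  "log_completely_monotonic W \<longleftrightarrow> (\<forall>n. \<forall>x>0. 0 \<le> (-1) ^ n * D n x)"
proof -
  have "(\<lambda>y. ln (W y)) differentiable (at x)" if "0 < x" for x
    using DERIV_ln_gamma_ratio [OF that] by (auto simp: real_differentiable_def)
  then show ?thesis
    using completely_monotonic_iff_derivatives [of D, OF DERIV_D deriv_ln_gamma_ratio] gamma_ratio_pos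
    by (simp add: log_completely_monotonic_def)
qed

lemma rho_pos: "0 < \<rho>"
  unfolding gamma_ratio_rho_def using A B
  by (intro mult_pos_pos prod_pos) (force simp: powr_gt_zero)+

lemma ln_rho: "ln \<rho> = (\<Sum>i=1..p. A i * ln (A i)) - (\<Sum>j=1..q. B j * ln (B j))"
proof -
  have 1: "0 < A i powr A i" if "i \<in> {1..p}" for i
    using A [OF that] by simp
  have 2: "0 < B j powr - B j" if "j \<in> {1..q}" for j
    using B [OF that] by simp
  have "ln \<rho> = ln (\<Prod>i=1..p. A i powr A i) + ln (\<Prod>j=1..q. B j powr - B j)"
    unfolding gamma_ratio_rho_def by (intro ln_mult_pos prod_pos 1 2)
  also have "\<dots> = (\<Sum>i=1..p. ln (A i powr A i)) + (\<Sum>j=1..q. ln (B j powr - B j))"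
    using 1 2 by (intro arg_cong2 [where f = "(+)"] ln_prod) auto
  also have "\<dots> = (\<Sum>i=1..p. A i * ln (A i)) + (\<Sum>j=1..q. - (B j * ln (B j)))"
    using A B by (intro arg_cong2 [where f = "(+)"] sum.cong) (auto simp: ln_powr)
  finally show ?thesis by (simp add: sum_negf)
qed

text \<open>
  Since \<open>A * Digamma (A * x + a) = A * ln x + A * ln A + o(1)\<close>, the shifts \<open>a\<close> and \<open>b\<close> drop out; the
  constants \<open>A * ln A\<close> and \<open>B * ln B\<close> add up to \<open>ln \<rho>\<close>.
\<close>

lemma D_asymptotics:
  "((\<lambda>x. D 0 x - ((\<Sum>j=1..q. B j) - (\<Sum>i=1..p. A i)) * ln x) \<longlongrightarrow> - ln \<rho>) at_top"
proof -
  have "((\<lambda>x. (\<Sum>j=1..q. scaled_Polygamma 0 (B j) (b j) x - B j * ln x) -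
         (\<Sum>i=1..p. scaled_Polygamma 0 (A i) (a i) x - A i * ln x)) \<longlongrightarrow>
         (\<Sum>j=1..q. B j * ln (B j)) - (\<Sum>i=1..p. A i * ln (A i))) at_top"
    by (intro tendsto_diff tendsto_sum tendsto_scaled_Digamma_minus_ln A a B b)
  moreover have "(\<Sum>j=1..q. scaled_Polygamma 0 (B j) (b j) x - B j * ln x) -
         (\<Sum>i=1..p. scaled_Polygamma 0 (A i) (a i) x - A i * ln x) =
         D 0 x - ((\<Sum>j=1..q. B j) - (\<Sum>i=1..p. A i)) * ln x" for x
    by (simp add: D_def sum_subtractf left_diff_distrib sum_distrib_right)
  ultimately show ?thesis by (simp add: ln_rho)
qed

text \<open>
  Divide the asymptotics by \<open>ln x\<close>: a bounded \<open>D 0\<close> forces the coefficient of \<open>ln x\<close> to vanish.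
\<close>

lemma balanced_if_D_bounded:
  assumes nonneg: "\<And>x. 1 \<le> x \<Longrightarrow> 0 \<le> D 0 x" and bdd: "\<And>x. 1 \<le> x \<Longrightarrow> D 0 x \<le> C"
  shows "(\<Sum>j=1..q. B j) = (\<Sum>i=1..p. A i)"
proof (rule ccontr)
  define S where "S = (\<Sum>j=1..q. B j) - (\<Sum>i=1..p. A i)"
  assume "(\<Sum>j=1..q. B j) \<noteq> (\<Sum>i=1..p. A i)"
  then have "S \<noteq> 0" by (simp add: S_def)
  have "((\<lambda>x. D 0 x / ln x) \<longlongrightarrow> 0) at_top"
  proof (rule tendsto_sandwich)
    show "eventually (\<lambda>x. 0 \<le> D 0 x / ln x) at_top"
      using eventually_ge_at_top [of 1] by eventually_elim (use nonneg in auto)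
    show "eventually (\<lambda>x. D 0 x / ln x \<le> C / ln x) at_top"
      using eventually_ge_at_top [of 1] by eventually_elim (use bdd in \<open>auto intro!: divide_right_mono\<close>)
  qed (real_asymp | simp)+
  moreover have "((\<lambda>x. (D 0 x - S * ln x) * (1 / ln x)) \<longlongrightarrow> - ln \<rho> * 0) at_top"
    using D_asymptotics unfolding S_def [symmetric] by (rule tendsto_mult) real_asymp
  ultimately have "((\<lambda>x. D 0 x / ln x - (D 0 x - S * ln x) * (1 / ln x)) \<longlongrightarrow> 0 - - ln \<rho> * 0) at_top"
    by (rule tendsto_diff)
  moreover have "eventually (\<lambda>x. D 0 x / ln x - (D 0 x - S * ln x) * (1 / ln x) = S) at_top"
    using eventually_gt_at_top [of 1] by eventually_elim (simp add: field_simps)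
  ultimately have "((\<lambda>x::real. S) \<longlongrightarrow> 0) at_top"
    by (simp add: tendsto_cong)
  with \<open>S \<noteq> 0\<close> show False
    by (simp add: tendsto_const_iff)
qed

lemma D_tendsto_if_balanced:
  assumes "(\<Sum>j=1..q. B j) = (\<Sum>i=1..p. A i)"
  shows "(D 0 \<longlongrightarrow> - ln \<rho>) at_top"
  using D_asymptotics assms by simp

text \<open>
  The signed sum of the inversion formulas of the factors. The order \<open>2 * j + 1\<close> is odd, which is
  why the derivative of \<open>D\<close> enters with a minus sign, the one required by complete monotonicity.
\<close>

lemma Post_Widder_P:
  assumes "0 < u"
  shows "(\<lambda>j. (real (2 * Suc j) / u) ^ (2 * Suc j) / fact (2 * j + 1) *
            - D (2 * j + 1) (real (2 * Suc j) / u)) \<longlonglongrightarrow> P u"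
proof -
  let ?g = "\<lambda>A a j. (real (2 * Suc j) / u) ^ (2 * Suc j) / fact (2 * j + 1) *
            scaled_Polygamma (2 * j + 1) A a (real (2 * Suc j) / u)"
  have "(\<lambda>n. (\<Sum>i=1..p. ?g (A i) (a i) n) - (\<Sum>j=1..q. ?g (B j) (b j) n)) \<longlonglongrightarrow> P u"
    unfolding P_eq by (intro tendsto_diff tendsto_sum Post_Widder_gamma_kernel A a B b assms)
  then show ?thesis
    unfolding D_def minus_diff_eq right_diff_distrib sum_distrib_left .
qed

lemma P_nonneg_if_log_completely_monotonic:
  assumes "log_completely_monotonic W" "0 < u"
  shows "0 \<le> P u"
proof (rule LIMSEQ_le_const [OF Post_Widder_P [OF assms(2)]], intro exI allI impI)
  fix j :: nat
  have "0 < real (2 * Suc j) / u" using assms by simp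
  with assms(1) have "0 \<le> (-1) ^ (2 * j + 1) * D (2 * j + 1) (real (2 * Suc j) / u)"
    unfolding log_completely_monotonic_iff_D by blast
  then have "0 \<le> - D (2 * j + 1) (real (2 * Suc j) / u)" by simp
  then show "0 \<le> (real (2 * Suc j) / u) ^ (2 * Suc j) / fact (2 * j + 1) *
            - D (2 * j + 1) (real (2 * Suc j) / u)"
    using assms(2) by (intro mult_nonneg_nonneg divide_nonneg_nonneg zero_le_power) auto
qed

lemma balanced_and_rho_if_log_completely_monotonic:
  assumes "log_completely_monotonic W"
  shows "(\<Sum>j=1..q. B j) = (\<Sum>i=1..p. A i)" and "\<rho> \<le> 1"
proof -
  have sign: "0 \<le> (-1) ^ n * D n x" if "0 < x" for n x
    using assms that unfolding log_completely_monotonic_iff_D by blast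
  have nonneg: "0 \<le> D 0 x" if "0 < x" for x
    using sign [OF that, of 0] by simp
  have "D 0 x \<le> D 0 1" if "1 \<le> x" for x
  proof (rule DERIV_nonpos_imp_nonincreasing [OF that])
    fix z :: real assume "1 \<le> z" "z \<le> x"
    then have "(D 0 has_real_derivative D 1 z) (at z)" "D 1 z \<le> 0"
      using DERIV_D [of z 0] sign [of z 1] by auto
    then show "\<exists>y. (D 0 has_real_derivative y) (at z) \<and> y \<le> 0" by blast
  qed
  with nonneg show bal: "(\<Sum>j=1..q. B j) = (\<Sum>i=1..p. A i)"
    by (intro balanced_if_D_bounded [of "D 0 1"]) auto
  have "eventually (\<lambda>x. 0 \<le> D 0 x) at_top"
    using eventually_gt_at_top [of 0] by eventually_elim (rule nonneg)
  then have "0 \<le> - ln \<rho>"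
    by (rule tendsto_lowerbound [OF D_tendsto_if_balanced [OF bal]]) simp
  then show "\<rho> \<le> 1" using rho_pos by simp
qed

text \<open>
  For \<open>n \<ge> 1\<close> the factor \<open>u ^ n\<close> cancels the pole \<open>1 / u\<close> of each summand of \<open>P\<close>, so every factor can
  be integrated separately.
\<close>

lemma has_bochner_integral_D:
  assumes "0 < x" "1 \<le> n"
  shows "has_bochner_integral lborel
           (\<lambda>u. indicator {0<..} u * (u ^ n * exp (- (x * u)) * P u)) ((-1) ^ n * D n x)"
proof -
  let ?I = "\<lambda>A a u. indicator {0<..} u * (u ^ n * exp (- (x * u)) * gamma_kernel A a u)"
  have "has_bochner_integral lborel
      (\<lambda>u. (\<Sum>i=1..p. ?I (A i) (a i) u) - (\<Sum>j=1..q. ?I (B j) (b j) u))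
      ((\<Sum>i=1..p. (-1) ^ Suc n * scaled_Polygamma n (A i) (a i) x) -
       (\<Sum>j=1..q. (-1) ^ Suc n * scaled_Polygamma n (B j) (b j) x))"
    by (intro has_bochner_integral_diff has_bochner_integral_sum
          has_bochner_integral_scaled_Polygamma A a B b assms)
  moreover have "(-1) ^ n * D n x = (\<Sum>i=1..p. (-1) ^ Suc n * scaled_Polygamma n (A i) (a i) x) -
       (\<Sum>j=1..q. (-1) ^ Suc n * scaled_Polygamma n (B j) (b j) x)"
    unfolding D_def right_diff_distrib sum_distrib_left by (simp add: sum_negf)
  ultimately show ?thesis
    by (simp only: P_eq right_diff_distrib sum_distrib_left)
qed

lemma has_bochner_integral_D_diff:
  assumes "0 < x" "x \<le> y"
  shows "has_bochner_integral lborel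
           (\<lambda>u. indicator {0<..} u * ((exp (- (x * u)) - exp (- (y * u))) * P u)) (D 0 x - D 0 y)"
proof -
  let ?I = "\<lambda>A a u. indicator {0<..} u * ((exp (- (x * u)) - exp (- (y * u))) * gamma_kernel A a u)"
  have "has_bochner_integral lborel
      (\<lambda>u. (\<Sum>i=1..p. ?I (A i) (a i) u) - (\<Sum>j=1..q. ?I (B j) (b j) u))
      ((\<Sum>i=1..p. scaled_Polygamma 0 (A i) (a i) y - scaled_Polygamma 0 (A i) (a i) x) -
       (\<Sum>j=1..q. scaled_Polygamma 0 (B j) (b j) y - scaled_Polygamma 0 (B j) (b j) x))"
    by (intro has_bochner_integral_diff has_bochner_integral_sum
          has_bochner_integral_scaled_Digamma_diff A a B b assms)
  moreover have "D 0 x - D 0 y =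
       (\<Sum>i=1..p. scaled_Polygamma 0 (A i) (a i) y - scaled_Polygamma 0 (A i) (a i) x) -
       (\<Sum>j=1..q. scaled_Polygamma 0 (B j) (b j) y - scaled_Polygamma 0 (B j) (b j) x)"
    by (simp add: D_def sum_subtractf)
  ultimately show ?thesis
    by (simp only: P_eq right_diff_distrib sum_distrib_left)
qed

text \<open>
  The kernels of the individual factors are not integrable at \<open>0\<close>, so their Laplace integrals cannot
  be added. Instead the difference formula is used at \<open>x\<close> and \<open>y = x + m\<close>: the integrands increase
  with \<open>m\<close> because \<open>P \<ge> 0\<close>, and \<open>D 0 (x + m)\<close> tends to \<open>- ln \<rho>\<close> because the parameters are balanced.
\<close>

lemma has_bochner_integral_laplace_P:
  assumes bal: "(\<Sum>j=1..q. B j) = (\<Sum>i=1..p. A i)"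
    and P: "\<And>u. 0 < u \<Longrightarrow> 0 \<le> P u"
    and x: "0 < x"
  shows "has_bochner_integral lborel (\<lambda>u. indicator {0<..} u * (exp (- (x * u)) * P u)) (D 0 x + ln \<rho>)"
proof -
  let ?f = "\<lambda>m::nat. \<lambda>u. indicator {0<..} u * ((exp (- (x * u)) - exp (- ((x + real m) * u))) * P u)"
  let ?u = "\<lambda>u. indicator {0<..} u * (exp (- (x * u)) * P u)"
  have int: "has_bochner_integral lborel (?f m) (D 0 x - D 0 (x + real m))" for m
    using x by (intro has_bochner_integral_D_diff) auto
  have mono: "mono (\<lambda>m. ?f m u)" for u
    using P by (auto simp: mono_def indicator_def intro!: mult_right_mono)
  have nonneg: "0 \<le> ?f m u" for m u
    using P [of u] by (auto simp: indicator_def intro!: mult_nonneg_nonneg mult_right_mono)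
  have lim: "(\<lambda>m. ?f m u) \<longlonglongrightarrow> ?u u" for u
  proof (cases "0 < u")
    case True
    then have "(\<lambda>m::nat. exp (- ((x + real m) * u))) \<longlonglongrightarrow> 0" by real_asymp
    then have "(\<lambda>m. ?f m u) \<longlonglongrightarrow> indicator {0<..} u * ((exp (- (x * u)) - 0) * P u)"
      by (intro tendsto_intros)
    then show ?thesis by simp
  qed simp
  have "filterlim (\<lambda>m. x + real m) at_top sequentially" by real_asymp
  from filterlim_compose [OF D_tendsto_if_balanced [OF bal] this]
  have ilim: "(\<lambda>m. integral\<^sup>L lborel (?f m)) \<longlonglongrightarrow> D 0 x + ln \<rho>"
    unfolding has_bochner_integral_integral_eq [OF int]
    by (auto intro!: tendsto_eq_intros)
  have meas: "?u \<in> borel_measurable lborel"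
    unfolding P_eq gamma_kernel_def by measurable
  note mct = integral_monotone_convergence_nonneg [of lborel ?f ?u "D 0 x + ln \<rho>"]
  show ?thesis
    unfolding has_bochner_integral_iff
    using mct int mono nonneg lim ilim meas by (simp add: has_bochner_integral_iff)
qed

lemma log_completely_monotonic_if:
  assumes bal: "(\<Sum>j=1..q. B j) = (\<Sum>i=1..p. A i)"
    and rho: "\<rho> \<le> 1"
    and P: "\<And>u. 0 < u \<Longrightarrow> 0 \<le> P u"
  shows "log_completely_monotonic W"
  unfolding log_completely_monotonic_iff_D
proof (intro allI impI)
  fix n :: nat and x :: real assume x: "0 < x"
  show "0 \<le> (-1) ^ n * D n x"
  proof (cases "n = 0")
    case True
    have "has_bochner_integral lborel (\<lambda>u. indicator {0<..} u * (exp (- (x * u)) * P u)) (D 0 x + ln \<rho>)"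
      using bal P x by (rule has_bochner_integral_laplace_P)
    then have "0 \<le> D 0 x + ln \<rho>"
      by (rule nonneg_has_bochner_integral) (use P in \<open>auto simp: indicator_def\<close>)
    moreover have "ln \<rho> \<le> 0" using rho rho_pos by simp
    ultimately show ?thesis using True by simp
  next
    case False
    then have "1 \<le> n" by simp
    show ?thesis
      using has_bochner_integral_D [OF x \<open>1 \<le> n\<close>]
      by (rule nonneg_has_bochner_integral) (use P in \<open>auto simp: indicator_def\<close>)
  qed
qed

end

theorem theorem4:
  fixes p q :: nat and A B a b :: "nat \<Rightarrow> real"
  assumes "1 \<le> p" and "1 \<le> q"
    and "\<And>i. i \<in> {1..p} \<Longrightarrow> 0 < A i"
    and "\<And>j. j \<in> {1..q} \<Longrightarrow> 0 < B j"
    and "\<And>i. i \<in> {1..p} \<Longrightarrow> 0 \<le> a i"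
    and "\<And>j. j \<in> {1..q} \<Longrightarrow> 0 \<le> b j"
  shows "(log_completely_monotonic (gamma_ratio p q A B a b) \<longleftrightarrow>
            (\<Sum>j=1..q. B j) = (\<Sum>i=1..p. A i) \<and>
            gamma_ratio_rho p q A B \<le> 1 \<and>
            (\<forall>u>0. 0 \<le> gamma_ratio_kernel p q A B a b u)) \<and>
         (log_completely_monotonic (gamma_ratio p q A B a b) \<longrightarrow>
            (\<forall>x>0.
               set_integrable lborel {0<..} (\<lambda>u. exp (- (x * u)) * gamma_ratio_kernel p q A B a b u) \<and>
               - deriv (\<lambda>y. ln (gamma_ratio p q A B a b y)) x =
                 (LINT u:{0<..}|lborel. exp (- (x * u)) * gamma_ratio_kernel p q A B a b u)
                 + ln (1 / gamma_ratio_rho p q A B)))"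
proof -
  interpret gamma_ratio_parameters p q A B a b
    by unfold_locales (use assms in auto)
  have iff: "log_completely_monotonic W \<longleftrightarrow>
      (\<Sum>j=1..q. B j) = (\<Sum>i=1..p. A i) \<and> \<rho> \<le> 1 \<and> (\<forall>u>0. 0 \<le> P u)"
    using log_completely_monotonic_if balanced_and_rho_if_log_completely_monotonic
      P_nonneg_if_log_completely_monotonic by blast
  have "set_integrable lborel {0<..} (\<lambda>u. exp (- (x * u)) * P u) \<and>
      - deriv (\<lambda>y. ln (W y)) x = (LINT u:{0<..}|lborel. exp (- (x * u)) * P u) + ln (1 / \<rho>)"
    if "log_completely_monotonic W" "0 < x" for x
  proof -
    have "has_bochner_integral lborel (\<lambda>u. indicator {0<..} u * (exp (- (x * u)) * P u)) (D 0 x + ln \<rho>)"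
      using that iff by (intro has_bochner_integral_laplace_P) auto
    then show ?thesis
      using deriv_ln_gamma_ratio [OF that(2)] rho_pos
      by (simp add: has_bochner_integral_iff set_integrable_def set_lebesgue_integral_def ln_div)
  qed
  with iff show ?thesis by blast
qed

end
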